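(* Suppose that $\mathfrak{G}=(g_0:\cdots:g_n):\mathbb{P}^n\dashrightarrow\mathbb{P}^n$ is a Cremona map of degree $d$ with inverse map $\mathfrak{G}^{-1}=(g'_0:\cdots:g'_n)$ and target inversion factor $D\in k[y_0,\ldots,y_n]$. Let $f,g\in R=k[x_0,\ldots,x_n]$ be relatively prime forms, with $\deg(f)\geq 1$ and $\deg(g)=d+\deg(f)$, such that $f(\mathbf g')$ and $g(\mathbf g')$ are nonzero as elements of $k[y_0,\ldots,y_n]$, where $\mathbf g'=(g'_0,\ldots,g'_n)$. Let $F\in k[y_0,\ldots,y_n,y_{n+1}]$ denote the implicit equation of the parametrization $(fg_0:\cdots:fg_n:g):\mathbb{P}^n\dashrightarrow\mathbb{P}^{n+1}$. Then: (i) Up to a nonzero scalar of $k$, $F$ is the $y_{n+1}$-monoid $$\frac{g(\mathbf g')-y_{n+1}f(\mathbf g')\,D}{\gcd(g(\mathbf g'),\,f(\mathbf g')\,D)}.$$ (ii) $\deg(F)=\deg(g)\deg(\mathfrak{G}^{-1})-\deg(\gcd(g(\mathbf g'),f(\mathbf g')D))=\deg(f)\deg(\mathfrak{G}^{-1})+\deg(D)+1-\deg(\gcd(g(\mathbf g'),f(\mathbf g')D))$. In particular, $\deg(F)\le\deg(g)\deg(\mathfrak{G}^{-1})$.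
   Context: $k$ is an infinite field. A Cremona map $\mathfrak G=(g_0:\cdots:g_n)$ of $\mathbb{P}^n$ of degree $d\ge1$ is given by forms $g_0,\ldots,g_n\in R=k[x_0,\ldots,x_n]$ of the same degree $d$ without nonconstant common factor that define a birational map of $\mathbb{P}^n$ onto itself; its inverse $\mathfrak G^{-1}=(g'_0:\cdots:g'_n)$ is given by forms $g'_0,\ldots,g'_n\in k[y_0,\ldots,y_n]$ of the same degree, denoted $\deg(\mathfrak G^{-1})$, also without nonconstant common factor. For a form $h\in R$, $h(\mathbf g')=h(g'_0,\ldots,g'_n)$. The target inversion factor $D\in k[y_0,\ldots,y_n]$ is the unique form with $g_i(\mathbf g')=y_iD$ for all $i=0,\ldots,n$. The implicit equation $F$ of $(fg_0:\cdots:fg_n:g)$ is the irreducible form (unique up to a nonzero scalar) generating the kernel of the $k$-algebra map $k[y_0,\ldots,y_{n+1}]\to R$, $y_i\mapsto fg_i$ $(0\le i\le n)$, $y_{n+1}\mapsto g$; it defines the image hypersurface. A $y_{n+1}$-monoid is a form of the shape $G+Hy_{n+1}$ with $G,H$ forms in $k[y_0,\ldots,y_n]$. *)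

theory Defs
  imports "HOL-Library.Poly_Mapping" "HOL-Computational_Algebra.Factorial_Ring"
begin

text \<open>
  Polynomials are finitely supported maps from monomials to coefficients, in variables indexed
  by \<open>nat\<close>. The ring \<open>k[x\<^sub>0,\<dots>,x\<^sub>n]\<close> is the subring \<open>polys (n + 1)\<close> below, so that
  \<open>k[y\<^sub>0,\<dots>,y\<^sub>n] \<subseteq> k[y\<^sub>0,\<dots>,y\<^sub>n\<^sub>+\<^sub>1]\<close> is a literal inclusion.
\<close>

type_synonym 'a mpoly = "(nat \<Rightarrow>\<^sub>0 nat) \<Rightarrow>\<^sub>0 'a"

definition Const :: "'a::zero \<Rightarrow> 'a mpoly" where
  "Const c = Poly_Mapping.single 0 c"

definition Var :: "nat \<Rightarrow> 'a::zero_neq_one mpoly" where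
  "Var i = Poly_Mapping.single (Poly_Mapping.single i 1) 1"

definition polys :: "nat \<Rightarrow> 'a::zero mpoly set" where
  "polys N = {p. \<forall>m\<in>Poly_Mapping.keys p. Poly_Mapping.keys m \<subseteq> {..<N}}"

definition monom_degree :: "(nat \<Rightarrow>\<^sub>0 nat) \<Rightarrow> nat" where
  "monom_degree m = (\<Sum>i\<in>Poly_Mapping.keys m. Poly_Mapping.lookup m i)"

text \<open>The zero polynomial gets total degree 0, but is a form of every degree.\<close>

definition total_degree :: "'a::zero mpoly \<Rightarrow> nat" where
  "total_degree p = Max (insert 0 (monom_degree ` Poly_Mapping.keys p))"

definition form_of_degree :: "nat \<Rightarrow> nat \<Rightarrow> 'a::zero mpoly \<Rightarrow> bool" where
  "form_of_degree N d p \<longleftrightarrow> p \<in> polys N \<and> (\<forall>m\<in>Poly_Mapping.keys p. monom_degree m = d)"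

definition form :: "nat \<Rightarrow> 'a::zero mpoly \<Rightarrow> bool" where
  "form N p \<longleftrightarrow> (\<exists>d. form_of_degree N d p)"

text \<open>The \<open>k\<close>-algebra map sending each variable \<open>i\<close> to \<open>s i\<close>.\<close>

definition psubst :: "(nat \<Rightarrow> 'a::comm_ring_1 mpoly) \<Rightarrow> 'a mpoly \<Rightarrow> 'a mpoly" where
  "psubst s p = (\<Sum>m\<in>Poly_Mapping.keys p. Const (Poly_Mapping.lookup p m) *
     (\<Prod>i\<in>Poly_Mapping.keys m. s i ^ Poly_Mapping.lookup m i))"

text \<open>
  Divisibility \<open>dvd\<close> is that of the ambient ring in infinitely many variables. Over a field,
  for members of \<open>polys N\<close> it agrees with divisibility inside \<open>polys N\<close>, as does irreducibility.
\<close>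

definition no_common_factor :: "nat \<Rightarrow> 'a::comm_ring_1 mpoly set \<Rightarrow> bool" where
  "no_common_factor N S \<longleftrightarrow>
     (\<forall>h\<in>polys N. (\<forall>p\<in>S. h dvd p) \<longrightarrow> total_degree h = 0)"

definition is_gcd :: "nat \<Rightarrow> 'a::comm_ring_1 mpoly \<Rightarrow> 'a mpoly \<Rightarrow> 'a mpoly \<Rightarrow> bool" where
  "is_gcd N h a b \<longleftrightarrow> h \<in> polys N \<and> h dvd a \<and> h dvd b \<and>
     (\<forall>c\<in>polys N. c dvd a \<and> c dvd b \<longrightarrow> c dvd h)"

text \<open>
  A rational self-map of \<open>\<P>\<^sup>n\<close> is represented by forms \<open>g 0, \<dots>, g n\<close> (later values of \<open>g\<close> are
  ignored) of equal degree, not all zero; proportional tuples represent the same map.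
\<close>

definition rational_map :: "nat \<Rightarrow> nat \<Rightarrow> (nat \<Rightarrow> 'a::comm_ring_1 mpoly) \<Rightarrow> bool" where
  "rational_map n d g \<longleftrightarrow> (\<forall>i\<le>n. form_of_degree (n + 1) d (g i)) \<and> (\<exists>i\<le>n. g i \<noteq> 0)"

definition proportional ::
    "nat \<Rightarrow> (nat \<Rightarrow> 'a::comm_ring_1 mpoly) \<Rightarrow> (nat \<Rightarrow> 'a mpoly) \<Rightarrow> bool" where
  "proportional n p q \<longleftrightarrow> (\<forall>i\<le>n. \<forall>j\<le>n. p i * q j = p j * q i)"

text \<open>\<open>g \<circ> h\<close> is defined as a rational map and equals the identity \<open>(x\<^sub>0 : \<dots> : x\<^sub>n)\<close>.\<close>

definition composes_to_id ::
    "nat \<Rightarrow> (nat \<Rightarrow> 'a::comm_ring_1 mpoly) \<Rightarrow> (nat \<Rightarrow> 'a mpoly) \<Rightarrow> bool" where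
  "composes_to_id n g h \<longleftrightarrow>
     (\<exists>i\<le>n. psubst h (g i) \<noteq> 0) \<and> proportional n (\<lambda>i. psubst h (g i)) Var"

definition mutually_inverse ::
    "nat \<Rightarrow> (nat \<Rightarrow> 'a::comm_ring_1 mpoly) \<Rightarrow> (nat \<Rightarrow> 'a mpoly) \<Rightarrow> bool" where
  "mutually_inverse n g h \<longleftrightarrow> composes_to_id n g h \<and> composes_to_id n h g"

definition cremona_map :: "nat \<Rightarrow> nat \<Rightarrow> (nat \<Rightarrow> 'a::comm_ring_1 mpoly) \<Rightarrow> bool" where
  "cremona_map n d g \<longleftrightarrow> d \<ge> 1 \<and> rational_map n d g \<and> no_common_factor (n + 1) (g ` {..n}) \<and>
     (\<exists>e h. rational_map n e h \<and> mutually_inverse n g h)"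

definition cremona_inverse ::
    "nat \<Rightarrow> (nat \<Rightarrow> 'a::comm_ring_1 mpoly) \<Rightarrow> nat \<Rightarrow> (nat \<Rightarrow> 'a mpoly) \<Rightarrow> bool" where
  "cremona_inverse n g d' g' \<longleftrightarrow> rational_map n d' g' \<and>
     no_common_factor (n + 1) (g' ` {..n}) \<and> mutually_inverse n g g'"

definition target_inversion_factor ::
    "nat \<Rightarrow> (nat \<Rightarrow> 'a::comm_ring_1 mpoly) \<Rightarrow> (nat \<Rightarrow> 'a mpoly) \<Rightarrow> 'a mpoly \<Rightarrow> bool" where
  "target_inversion_factor n g g' D \<longleftrightarrow>
     form (n + 1) D \<and> (\<forall>i\<le>n. psubst g' (g i) = Var i * D)"

text \<open>
  \<open>F\<close> is an implicit equation of the hypersurface parametrized by \<open>(s 0 : \<dots> : s (N - 1))\<close>.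
\<close>

definition implicit_equation ::
    "nat \<Rightarrow> (nat \<Rightarrow> 'a::comm_ring_1 mpoly) \<Rightarrow> 'a mpoly \<Rightarrow> bool" where
  "implicit_equation N s F \<longleftrightarrow> form N F \<and> irreducible F \<and>
     {P \<in> polys N. psubst s P = 0} = {F * Q |Q. Q \<in> polys N}"

definition monoid_form :: "nat \<Rightarrow> 'a::comm_ring_1 mpoly \<Rightarrow> bool" where
  "monoid_form n Q \<longleftrightarrow> form (n + 2) Q \<and>
     (\<exists>G H. form (n + 1) G \<and> form (n + 1) H \<and> Q = G + H * Var (n + 1))"

end

theory Submission
  imports Defs "HOL-Computational_Algebra.Polynomial"
begin

text \<open>
  Write \<open>a = g(g')\<close>, \<open>b = f(g') D\<close>, \<open>y = y\<^sub>n\<^sub>+\<^sub>1\<close>, and let \<open>\<phi>\<close> be the substitution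
  \<open>y\<^sub>i \<mapsto> f g\<^sub>i\<close>, \<open>y \<mapsto> g\<close>.

  Since the inverse map undoes the Cremona map, \<open>\<phi>(h(g'))\<close> is, for a form \<open>h\<close>, the form \<open>h\<close> times a
  nonzero factor that depends only on its degree (\<open>psubst_through_inverse\<close>). Hence \<open>\<phi>(a)\<close> and \<open>\<phi>(y b)\<close>
  are both \<open>g\<close> times such factors, and the factors agree because the degrees do
  (\<open>cremona_implicit_vanishing\<close>). So \<open>a - y b\<close> lies in the kernel of \<open>\<phi>\<close>, while \<open>\<phi>(a) \<noteq> 0\<close>.

  The kernel is generated by \<open>F\<close>, so \<open>a - y b = F R\<close>. Counting degrees in \<open>y\<close>, one of \<open>F\<close> and \<open>R\<close> is free
  of \<open>y\<close>. It is not \<open>F\<close>, as otherwise setting \<open>y = 0\<close> shows that \<open>F\<close> divides \<open>a\<close>, and \<open>\<phi>(a)\<close> would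
  vanish. So \<open>R\<close> is free of \<open>y\<close> and divides both \<open>a\<close> and \<open>b\<close>. In fact \<open>R\<close> is their greatest common divisor: if \<open>c\<close> divides both,
  then \<open>F R = c (a/c - y b/c)\<close>, where \<open>\<phi>(c) \<noteq> 0\<close> because \<open>c\<close> divides \<open>a\<close>; so \<open>\<phi>\<close> kills
  \<open>a/c - y b/c\<close>, which is therefore a multiple of \<open>F\<close>, and \<open>c\<close> divides \<open>R\<close>. This argument
  (\<open>linear_kernel_element_gcd\<close>) yields the existence of the gcd from that of \<open>F\<close>. Any other
  gcd differs from \<open>R\<close> by a constant (\<open>is_gcd_unique\<close>), and the degree formulas follow by additivity of the total degree.
\<close>

section \<open>Substitution as a ring homomorphism\<close>

lemma sum_single_keys:
  "(\<Sum>m\<in>Poly_Mapping.keys p. Poly_Mapping.single m (Poly_Mapping.lookup p m)) = p"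
proof (rule poly_mapping_eqI)
  fix k
  have "(\<Sum>m\<in>Poly_Mapping.keys p.
          Poly_Mapping.lookup (Poly_Mapping.single m (Poly_Mapping.lookup p m)) k)
      = (\<Sum>m\<in>Poly_Mapping.keys p. if k = m then Poly_Mapping.lookup p k else 0)"
    by (rule sum.cong) (auto simp: lookup_single when_def)
  also have "\<dots> = Poly_Mapping.lookup p k"
    by (simp add: in_keys_iff)
  finally show "Poly_Mapping.lookup
      (\<Sum>m\<in>Poly_Mapping.keys p. Poly_Mapping.single m (Poly_Mapping.lookup p m)) k
      = Poly_Mapping.lookup p k"
    by (simp add: lookup_sum)
qed

text \<open>
  The common source of multiplicativity for substitution and for gradings: both are additive
  extensions of a map on terms \<open>c m\<close> that respects products of terms.
\<close>

lemma sum_keys_mult: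
  fixes \<phi> :: "'m::monoid_add \<Rightarrow> 'c::semiring_0 \<Rightarrow> 'b::semiring_0"
  assumes zero: "\<And>m. \<phi> m 0 = 0"
    and add: "\<And>m c c'. \<phi> m (c + c') = \<phi> m c + \<phi> m c'"
    and mult: "\<And>m m' c c'. \<phi> (m + m') (c * c') = \<phi> m c * \<phi> m' c'"
  shows "(\<Sum>m\<in>Poly_Mapping.keys (p * q). \<phi> m (Poly_Mapping.lookup (p * q) m))
    = (\<Sum>m\<in>Poly_Mapping.keys p. \<phi> m (Poly_Mapping.lookup p m)) *
      (\<Sum>m\<in>Poly_Mapping.keys q. \<phi> m (Poly_Mapping.lookup q m))"
proof -
  let ?L = "\<lambda>p. \<Sum>m\<in>Poly_Mapping.keys p. \<phi> m (Poly_Mapping.lookup p m)"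
  have L_add: "?L (p + q) = ?L p + ?L q" for p q
    by (rule setsum_keys_plus_distrib) (simp_all add: zero add)
  have L_single: "?L (Poly_Mapping.single m c) = \<phi> m c" for m c
    by (simp add: zero)
  have L_sum: "?L (sum h A) = (\<Sum>x\<in>A. ?L (h x))" for h and A :: "'m set"
    by (induction A rule: infinite_finite_induct) (simp_all add: L_add)
  have "p * q = (\<Sum>m\<in>Poly_Mapping.keys p. \<Sum>m'\<in>Poly_Mapping.keys q.
      Poly_Mapping.single (m + m') (Poly_Mapping.lookup p m * Poly_Mapping.lookup q m'))"
    by (subst (1) sum_single_keys [of p, symmetric], subst (1) sum_single_keys [of q, symmetric])
      (simp add: sum_product mult_single)
  then have "?L (p * q) = (\<Sum>m\<in>Poly_Mapping.keys p. \<Sum>m'\<in>Poly_Mapping.keys q.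
      \<phi> (m + m') (Poly_Mapping.lookup p m * Poly_Mapping.lookup q m'))"
    by (simp only: L_sum L_single)
  also have "\<dots> = ?L p * ?L q"
    by (simp add: mult sum_product)
  finally show ?thesis .
qed

lemma Const_simps [simp]:
  "Const 0 = 0"
  "Const 1 = 1"
  "Const (a + b) = Const a + Const b"
  "Const (a * b) = Const a * Const b"
  by (simp_all add: Const_def single_add mult_single)

definition monom_eval :: "(nat \<Rightarrow> 'b) \<Rightarrow> (nat \<Rightarrow>\<^sub>0 nat) \<Rightarrow> 'b::comm_ring_1" where
  "monom_eval s m = (\<Prod>i\<in>Poly_Mapping.keys m. s i ^ Poly_Mapping.lookup m i)"

lemma monom_eval_superset:
  assumes "finite A" "Poly_Mapping.keys m \<subseteq> A"
  shows "monom_eval s m = (\<Prod>i\<in>A. s i ^ Poly_Mapping.lookup m i)"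
  unfolding monom_eval_def
  by (rule prod.mono_neutral_left) (use assms in \<open>auto simp: in_keys_iff\<close>)

lemma monom_eval_add: "monom_eval s (m + m') = monom_eval s m * monom_eval s m'"
proof -
  let ?A = "Poly_Mapping.keys m \<union> Poly_Mapping.keys m'"
  have "Poly_Mapping.keys (m + m') \<subseteq> ?A"
    by (rule Poly_Mapping.keys_add)
  then show ?thesis
    by (simp add: monom_eval_superset [of ?A] lookup_add power_add prod.distrib)
qed

lemma psubst_alt:
  "psubst s p = (\<Sum>m\<in>Poly_Mapping.keys p. Const (Poly_Mapping.lookup p m) * monom_eval s m)"
  by (simp add: psubst_def monom_eval_def)

lemma psubst_0 [simp]: "psubst s 0 = 0"
  by (simp add: psubst_def)

lemma psubst_add: "psubst s (p + q) = psubst s p + psubst s q"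
  unfolding psubst_alt by (rule setsum_keys_plus_distrib) (simp_all add: algebra_simps)

lemma psubst_mult: "psubst s (p * q) = psubst s p * psubst s q"
  unfolding psubst_alt by (rule sum_keys_mult) (simp_all add: algebra_simps monom_eval_add)

lemma psubst_diff: "psubst s (p - q) = psubst s p - psubst s q"
  using psubst_add [of s "p - q" q] by simp

lemma psubst_sum: "psubst s (sum h A) = (\<Sum>x\<in>A. psubst s (h x))"
  by (induction A rule: infinite_finite_induct) (simp_all add: psubst_add)

lemma psubst_single: "psubst s (Poly_Mapping.single m c) = Const c * monom_eval s m"
  by (simp add: psubst_alt)

lemma psubst_Const [simp]: "psubst s (Const c) = Const c"
  by (simp add: Const_def psubst_single) (simp add: monom_eval_def)

lemma psubst_Var [simp]: "psubst s (Var i) = s i"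
  by (simp add: Var_def psubst_single) (simp add: monom_eval_def)

lemma psubst_power: "psubst s (p ^ k) = psubst s p ^ k"
proof (induction k)
  case 0
  show ?case using psubst_Const [of s 1] by simp
qed (simp add: psubst_mult)

lemma psubst_monom_eval: "psubst s (monom_eval t m) = monom_eval (\<lambda>i. psubst s (t i)) m"
proof -
  have "psubst s (\<Prod>i\<in>A. t i ^ k i) = (\<Prod>i\<in>A. psubst s (t i) ^ k i)" for A k
    using psubst_Const [of s 1]
    by (induction A rule: infinite_finite_induct) (simp_all add: psubst_mult psubst_power)
  then show ?thesis
    by (simp add: monom_eval_def)
qed

lemma psubst_psubst: "psubst s (psubst t p) = psubst (\<lambda>i. psubst s (t i)) p"
proof -
  have "psubst s (psubst t p) = (\<Sum>m\<in>Poly_Mapping.keys p.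
      psubst s (Const (Poly_Mapping.lookup p m) * monom_eval t m))"
    by (subst psubst_alt [of t]) (rule psubst_sum)
  then show ?thesis
    by (simp add: psubst_mult psubst_monom_eval psubst_alt [of "\<lambda>i. psubst s (t i)"])
qed

lemma monom_eval_Var: "monom_eval Var m = Poly_Mapping.single m 1"
proof -
  have pow: "Var i ^ k = (Poly_Mapping.single (Poly_Mapping.single i k) 1 :: 'a mpoly)" for i k
    by (induction k) (simp_all add: Var_def mult_single flip: single_add)
  have "(\<Prod>i\<in>A. Poly_Mapping.single (h i) 1) =
      (Poly_Mapping.single (\<Sum>i\<in>A. h i) 1 :: 'a mpoly)" for h and A :: "nat set"
    by (induction A rule: infinite_finite_induct) (simp_all add: mult_single)
  then show ?thesis
    by (simp add: monom_eval_def pow sum_single_keys)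
qed

lemma psubst_Var_id: "psubst Var p = p"
  by (simp add: psubst_alt monom_eval_Var Const_def mult_single sum_single_keys)

lemma psubst_cong:
  assumes "p \<in> polys N" "\<And>i. i < N \<Longrightarrow> s i = t i"
  shows "psubst s p = psubst t p"
  unfolding psubst_def
proof (intro sum.cong refl arg_cong2 [where f = times] prod.cong)
  fix m i assume "m \<in> Poly_Mapping.keys p" "i \<in> Poly_Mapping.keys m"
  then show "s i ^ Poly_Mapping.lookup m i = t i ^ Poly_Mapping.lookup m i"
    using assms by (metis (mono_tags, lifting) mem_Collect_eq lessThan_iff polys_def subsetD)
qed

lemma psubst_fixes:
  assumes "p \<in> polys N" "\<And>i. i < N \<Longrightarrow> s i = Var i"
  shows "psubst s p = p"
  using psubst_cong [of p N s Var] assms by (simp add: psubst_Var_id)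

text \<open>
  Homogeneity: a common factor of the substituted polynomials can be pulled out of a form.
\<close>

lemma psubst_scale:
  assumes "form_of_degree N e p" "\<And>i. i < N \<Longrightarrow> t i = c * s i"
  shows "psubst t p = c ^ e * psubst s p"
proof -
  have "psubst t p = psubst (\<lambda>i. c * s i) p"
    using assms by (intro psubst_cong [of p N]) (auto simp: form_of_degree_def)
  also have "\<dots> = (\<Sum>m\<in>Poly_Mapping.keys p.
      c ^ e * (Const (Poly_Mapping.lookup p m) * monom_eval s m))"
    unfolding psubst_alt
  proof (rule sum.cong [OF refl])
    fix m assume "m \<in> Poly_Mapping.keys p"
    then have "e = (\<Sum>i\<in>Poly_Mapping.keys m. Poly_Mapping.lookup m i)"
      using assms by (auto simp: form_of_degree_def monom_degree_def)
    then show "Const (Poly_Mapping.lookup p m) * monom_eval (\<lambda>i. c * s i) m =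
        c ^ e * (Const (Poly_Mapping.lookup p m) * monom_eval s m)"
      by (simp add: monom_eval_def power_mult_distrib prod.distrib power_sum)
  qed
  also have "\<dots> = c ^ e * psubst s p"
    by (simp add: psubst_alt sum_distrib_left)
  finally show ?thesis .
qed

section \<open>Closure of forms under ring operations and substitution\<close>

lemma monom_degree_add: "monom_degree (m + m') = monom_degree m + monom_degree m'"
  unfolding monom_degree_def by (rule setsum_keys_plus_distrib) simp_all

lemma polys_mono: "N \<le> M \<Longrightarrow> p \<in> polys N \<Longrightarrow> p \<in> polys M"
  by (force simp: polys_def)

lemma polys_diff:
  fixes p q :: "'a::ab_group_add mpoly"
  shows "p \<in> polys N \<Longrightarrow> q \<in> polys N \<Longrightarrow> p - q \<in> polys N"
proof -
  assume "p \<in> polys N" "q \<in> polys N"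
  moreover have "m \<in> Poly_Mapping.keys p \<or> m \<in> Poly_Mapping.keys q"
    if "m \<in> Poly_Mapping.keys (p - q)" for m
    using that by (auto simp: in_keys_iff lookup_minus)
  ultimately show ?thesis
    unfolding polys_def by (simp, metis)
qed

lemma polys_mult:
  assumes "p \<in> polys N" "q \<in> polys N"
  shows "p * q \<in> polys N"
  unfolding polys_def
proof safe
  fix m i assume "m \<in> Poly_Mapping.keys (p * q)" "i \<in> Poly_Mapping.keys m"
  then obtain k l where "m = k + l" "k \<in> Poly_Mapping.keys p" "l \<in> Poly_Mapping.keys q"
    using keys_mult [of p q] by blast
  with \<open>i \<in> Poly_Mapping.keys m\<close> Poly_Mapping.keys_add [of k l] assms show "i < N"
    unfolding polys_def by blast
qed

lemma Var_in_polys: "i < N \<Longrightarrow> Var i \<in> polys N"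
  by (auto simp: Var_def polys_def)

lemma form_of_degree_0: "form_of_degree N e 0"
  by (simp add: form_of_degree_def polys_def)

lemma form_of_degree_Const: "form_of_degree N 0 (Const c)"
  by (simp add: form_of_degree_def polys_def Const_def monom_degree_def)

lemma form_of_degree_1: "form_of_degree N 0 (1 :: 'a::comm_ring_1 mpoly)"
  using form_of_degree_Const [of N "1 :: 'a"] by simp

lemma form_of_degree_Var: "i < N \<Longrightarrow> form_of_degree N 1 (Var i)"
  by (simp add: form_of_degree_def Var_in_polys) (simp add: Var_def monom_degree_def)

lemma form_of_degree_add:
  assumes "form_of_degree N e p" "form_of_degree N e q"
  shows "form_of_degree N e (p + q)"
proof -
  have "m \<in> Poly_Mapping.keys p \<or> m \<in> Poly_Mapping.keys q" if "m \<in> Poly_Mapping.keys (p + q)" for m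
    using that Poly_Mapping.keys_add [of p q] by auto
  with assms show ?thesis
    by (auto simp: form_of_degree_def polys_def) (metis lessThan_iff subsetD)+
qed

lemma form_of_degree_diff:
  fixes p q :: "'a::ab_group_add mpoly"
  assumes "form_of_degree N e p" "form_of_degree N e q"
  shows "form_of_degree N e (p - q)"
proof -
  have "m \<in> Poly_Mapping.keys p \<or> m \<in> Poly_Mapping.keys q" if "m \<in> Poly_Mapping.keys (p - q)" for m
    using that by (auto simp: in_keys_iff lookup_minus)
  with assms show ?thesis
    unfolding form_of_degree_def by (blast intro: polys_diff)
qed

lemma form_of_degree_mult:
  assumes "form_of_degree N e p" "form_of_degree N e' q"
  shows "form_of_degree N (e + e') (p * q)"
  unfolding form_of_degree_def
proof (intro conjI ballI)
  show "p * q \<in> polys N"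
    using assms by (simp add: form_of_degree_def polys_mult)
  fix m assume "m \<in> Poly_Mapping.keys (p * q)"
  then obtain k l where "m = k + l" "k \<in> Poly_Mapping.keys p" "l \<in> Poly_Mapping.keys q"
    using keys_mult [of p q] by blast
  with assms show "monom_degree m = e + e'"
    by (simp add: form_of_degree_def monom_degree_add)
qed

lemma form_of_degree_sum:
  "(\<And>x. x \<in> A \<Longrightarrow> form_of_degree N e (h x)) \<Longrightarrow> form_of_degree N e (sum h A)"
  by (induction A rule: infinite_finite_induct) (simp_all add: form_of_degree_0 form_of_degree_add)

lemma form_of_degree_power:
  fixes p :: "'a::comm_ring_1 mpoly"
  assumes "form_of_degree N e p"
  shows "form_of_degree N (k * e) (p ^ k)"
  by (induction k) (simp_all add: form_of_degree_1 form_of_degree_mult assms)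

lemma form_of_degree_prod:
  fixes h :: "'b \<Rightarrow> 'a::comm_ring_1 mpoly"
  assumes "finite A" "\<And>x. x \<in> A \<Longrightarrow> form_of_degree N (e x) (h x)"
  shows "form_of_degree N (sum e A) (prod h A)"
  using assms by (induction A) (simp_all add: form_of_degree_1 form_of_degree_mult)

lemma form_of_degree_psubst:
  assumes p: "form_of_degree N e p" and s: "\<And>i. i < N \<Longrightarrow> form_of_degree M e' (s i)"
  shows "form_of_degree M (e * e') (psubst s p)"
  unfolding psubst_def
proof (rule form_of_degree_sum)
  fix m assume m: "m \<in> Poly_Mapping.keys p"
  have "form_of_degree M (\<Sum>i\<in>Poly_Mapping.keys m. Poly_Mapping.lookup m i * e')
      (\<Prod>i\<in>Poly_Mapping.keys m. s i ^ Poly_Mapping.lookup m i)"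
    using p m s
    by (intro form_of_degree_prod form_of_degree_power) (auto simp: form_of_degree_def polys_def)
  moreover have "(\<Sum>i\<in>Poly_Mapping.keys m. Poly_Mapping.lookup m i * e') = e * e'"
    using p m by (simp add: form_of_degree_def monom_degree_def flip: sum_distrib_right)
  ultimately show "form_of_degree M (e * e') (Const (Poly_Mapping.lookup p m) *
      (\<Prod>i\<in>Poly_Mapping.keys m. s i ^ Poly_Mapping.lookup m i))"
    using form_of_degree_mult [OF form_of_degree_Const] by force
qed

lemma total_degree_form:
  fixes p :: "'a::comm_ring_1 mpoly"
  assumes "form_of_degree N e p" "p \<noteq> 0"
  shows "total_degree p = e"
proof -
  have "Poly_Mapping.keys p \<noteq> {}"
    using assms(2) sum_single_keys [of p] by auto
  then have "monom_degree ` Poly_Mapping.keys p = {e}"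
    using assms(1) unfolding form_of_degree_def by (metis image_cong image_constant_conv)
  then show ?thesis
    by (simp add: total_degree_def)
qed

lemma form_of_total_degree:
  fixes p :: "'a::comm_ring_1 mpoly"
  assumes "form N p" "p \<noteq> 0"
  shows "form_of_degree N (total_degree p) p"
proof -
  obtain e where "form_of_degree N e p"
    using assms(1) by (auto simp: form_def)
  then show ?thesis
    using total_degree_form [OF _ assms(2)] by metis
qed

section \<open>Weighted degrees\<close>

definition weight :: "(nat \<Rightarrow> nat) \<Rightarrow> (nat \<Rightarrow>\<^sub>0 nat) \<Rightarrow> nat" where
  "weight w m = (\<Sum>i\<in>Poly_Mapping.keys m. w i * Poly_Mapping.lookup m i)"

lemma weight_add: "weight w (m + m') = weight w m + weight w m'"
  unfolding weight_def by (rule setsum_keys_plus_distrib) (simp_all add: algebra_simps)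

text \<open>
  The ring homomorphism \<open>x\<^sub>i \<mapsto> x\<^sub>i t\<^bsup>w i\<^esup>\<close> into univariate polynomials in \<open>t\<close>. Its degree in \<open>t\<close> is the
  weighted degree, which therefore inherits additivity from univariate polynomials over a domain.
\<close>

definition grading :: "(nat \<Rightarrow> nat) \<Rightarrow> 'a::comm_ring_1 mpoly \<Rightarrow> 'a mpoly poly" where
  "grading w p = (\<Sum>m\<in>Poly_Mapping.keys p.
     monom (Poly_Mapping.single m (Poly_Mapping.lookup p m)) (weight w m))"

lemma grading_diff: "grading w (p - q) = grading w p - grading w q"
proof -
  have "grading w (p + q) = grading w p + grading w q" for p q :: "'a mpoly"
    unfolding grading_def
    by (rule setsum_keys_plus_distrib) (simp_all add: single_add add_monom)
  from this [of "p - q" q] show ?thesis by (simp add: algebra_simps)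
qed

lemma grading_mult: "grading w (p * q) = grading w p * grading w q"
  unfolding grading_def
  by (rule sum_keys_mult) (simp_all add: single_add add_monom mult_monom mult_single weight_add)

lemma lookup_coeff_grading:
  "Poly_Mapping.lookup (coeff (grading w p) k) m =
     (if weight w m = k then Poly_Mapping.lookup p m else 0)"
proof -
  have "Poly_Mapping.lookup (coeff (grading w p) k) m = (\<Sum>m'\<in>Poly_Mapping.keys p.
      if m' = m then if weight w m = k then Poly_Mapping.lookup p m else 0 else 0)"
    unfolding grading_def coeff_sum lookup_sum
    by (rule sum.cong) (auto simp: lookup_single when_def)
  then show ?thesis
    by (simp add: in_keys_iff)
qed

definition weighted_degree :: "(nat \<Rightarrow> nat) \<Rightarrow> 'a::comm_ring_1 mpoly \<Rightarrow> nat" where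
  "weighted_degree w p = degree (grading w p)"

lemma weighted_degree_le_iff:
  "weighted_degree w p \<le> k \<longleftrightarrow> (\<forall>m\<in>Poly_Mapping.keys p. weight w m \<le> k)"
proof
  assume "weighted_degree w p \<le> k"
  show "\<forall>m\<in>Poly_Mapping.keys p. weight w m \<le> k"
  proof
    fix m assume "m \<in> Poly_Mapping.keys p"
    then have "Poly_Mapping.lookup (coeff (grading w p) (weight w m)) m \<noteq> 0"
      by (simp add: lookup_coeff_grading in_keys_iff)
    then have "coeff (grading w p) (weight w m) \<noteq> 0"
      by force
    then show "weight w m \<le> k"
      using le_degree \<open>weighted_degree w p \<le> k\<close> unfolding weighted_degree_def by fastforce
  qed
next
  assume *: "\<forall>m\<in>Poly_Mapping.keys p. weight w m \<le> k"
  show "weighted_degree w p \<le> k"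
    unfolding weighted_degree_def
  proof (intro degree_le allI impI poly_mapping_eqI)
    fix l m assume "k < l"
    with * have "weight w m = l \<Longrightarrow> m \<notin> Poly_Mapping.keys p"
      by auto
    then show "Poly_Mapping.lookup (coeff (grading w p) l) m = Poly_Mapping.lookup 0 m"
      by (simp add: lookup_coeff_grading in_keys_iff)
  qed
qed

lemma grading_eq_0_iff: "grading w p = 0 \<longleftrightarrow> p = 0"
proof
  assume "grading w p = 0"
  then show "p = 0"
    using lookup_coeff_grading [of w p] by (intro poly_mapping_eqI) (metis coeff_0 lookup_zero)
qed (simp add: grading_def)

lemma weighted_degree_mult:
  fixes p q :: "'a::idom mpoly"
  assumes "p \<noteq> 0" "q \<noteq> 0"
  shows "weighted_degree w (p * q) = weighted_degree w p + weighted_degree w q"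
  using assms by (simp add: weighted_degree_def grading_mult degree_mult_eq grading_eq_0_iff)

lemma weighted_degree_diff_le:
  assumes "weighted_degree w p \<le> k" "weighted_degree w q \<le> k"
  shows "weighted_degree w (p - q) \<le> k"
  using assms unfolding weighted_degree_def grading_diff by (rule degree_diff_le)

lemma total_degree_eq_weighted_degree: "total_degree p = weighted_degree (\<lambda>_. 1) p"
proof -
  have "total_degree p \<le> k \<longleftrightarrow> weighted_degree (\<lambda>_. 1) p \<le> k" for k
    by (auto simp: total_degree_def weighted_degree_le_iff weight_def monom_degree_def)
  then show ?thesis
    by (metis order_antisym order_refl)
qed

lemma total_degree_mult:
  fixes p q :: "'a::idom mpoly"
  assumes "p \<noteq> 0" "q \<noteq> 0"
  shows "total_degree (p * q) = total_degree p + total_degree q"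
  using weighted_degree_mult [OF assms] by (simp add: total_degree_eq_weighted_degree)

lemma total_degree_eq_0_imp_Const:
  assumes "total_degree p = 0"
  obtains c where "p = Const c"
proof
  have "m = 0" if "m \<in> Poly_Mapping.keys p" for m
  proof -
    have "monom_degree m \<le> total_degree p"
      unfolding total_degree_def using that by (intro Max_ge) simp_all
    then have "monom_degree m = 0"
      using assms by simp
    then show "m = 0"
      by (intro poly_mapping_eqI) (auto simp: monom_degree_def in_keys_iff)
  qed
  then show "p = Const (Poly_Mapping.lookup p 0)"
    by (intro poly_mapping_eqI) (auto simp: Const_def lookup_single when_def in_keys_iff)
qed

text \<open>
  Weighting only the variables of index at least \<open>N\<close> makes membership in \<open>polys N\<close> a degree condition,
  and for members of \<open>polys (Suc N)\<close> gives the degree in the last variable.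
\<close>

abbreviation degree_beyond :: "nat \<Rightarrow> 'a::comm_ring_1 mpoly \<Rightarrow> nat" where
  "degree_beyond N \<equiv> weighted_degree (\<lambda>i. of_bool (N \<le> i))"

lemma polys_iff_degree_beyond: "p \<in> polys N \<longleftrightarrow> degree_beyond N p = 0"
proof -
  have "weight (\<lambda>i. of_bool (N \<le> i)) m = 0 \<longleftrightarrow> Poly_Mapping.keys m \<subseteq> {..<N}" for m
    by (auto simp: weight_def in_keys_iff of_bool_def not_le)
  then show ?thesis
    using weighted_degree_le_iff [of "\<lambda>i. of_bool (N \<le> i)" p 0] by (simp add: polys_def)
qed

text \<open>
  This bridges divisibility in the ambient ring and divisibility inside \<open>polys N\<close>.
\<close>

lemma polys_cofactor:
  fixes p q :: "'a::idom mpoly"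
  assumes "p * q \<in> polys N" "p * q \<noteq> 0"
  shows "q \<in> polys N"
  using assms by (auto simp: polys_iff_degree_beyond weighted_degree_mult)

lemma degree_beyond_Var: "degree_beyond N (Var N) \<le> 1"
  unfolding weighted_degree_le_iff by (simp add: Var_def weight_def)

lemma form_of_degree_Var_cofactor:
  fixes q :: "'a::idom mpoly"
  assumes "form_of_degree N e (Var v * q)" "q \<in> polys N"
  shows "form_of_degree N (e - 1) q"
proof -
  \<comment> \<open>multiplication by a monomial only shifts the coefficients, so nothing cancels\<close>
  have shift: "Poly_Mapping.lookup (Poly_Mapping.single k 1 * q) (k + m) = Poly_Mapping.lookup q m"
    for k m
  proof -
    have "Poly_Mapping.single k 1 * q =
        (\<Sum>l\<in>Poly_Mapping.keys q. Poly_Mapping.single (k + l) (Poly_Mapping.lookup q l))"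
      by (subst sum_single_keys [of q, symmetric]) (simp add: sum_distrib_left mult_single)
    also have "Poly_Mapping.lookup \<dots> (k + m) =
        Poly_Mapping.lookup (\<Sum>l\<in>Poly_Mapping.keys q. Poly_Mapping.single l (Poly_Mapping.lookup q l)) m"
      unfolding lookup_sum by (rule sum.cong) (auto simp: lookup_single when_def)
    finally show ?thesis
      by (simp add: sum_single_keys)
  qed
  have "monom_degree m = e - 1" if "m \<in> Poly_Mapping.keys q" for m
  proof -
    have "Poly_Mapping.single v 1 + m \<in> Poly_Mapping.keys (Var v * q)"
      using that by (simp add: Var_def in_keys_iff shift)
    then have "monom_degree (Poly_Mapping.single v 1) + monom_degree m = e"
      using assms(1) by (simp add: form_of_degree_def flip: monom_degree_add)
    then show ?thesis
      by (simp add: monom_degree_def)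
  qed
  with assms(2) show ?thesis
    by (simp add: form_of_degree_def)
qed


section \<open>The generator of a kernel containing a linear polynomial\<close>

text \<open>
  Setting the last variable to zero preserves homogeneity and isolates \<open>a\<close>; then \<open>x\<^sub>N b\<close> is a
  difference of forms of degree \<open>e\<close>.
\<close>

lemma form_of_degree_linear_coefficients:
  fixes a b :: "'a::idom mpoly"
  assumes form: "form_of_degree (Suc N) e (a - Var N * b)"
    and a: "a \<in> polys N" and b: "b \<in> polys N"
  shows "form_of_degree N e a" "form_of_degree N (e - 1) b"
proof -
  let ?\<rho> = "Var(N := 0) :: nat \<Rightarrow> 'a mpoly"
  have "psubst ?\<rho> (a - Var N * b) = a"
    using a by (simp add: psubst_diff psubst_mult psubst_fixes)
  moreover have "form_of_degree N 1 (?\<rho> i)" if "i < Suc N" for i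
    using that form_of_degree_Var [of i N] by (auto simp: form_of_degree_0)
  ultimately show fa: "form_of_degree N e a"
    using form_of_degree_psubst [OF form, of N 1 ?\<rho>] by simp
  then have "form_of_degree (Suc N) e a"
    by (auto simp: form_of_degree_def intro: polys_mono [of N])
  then have "form_of_degree (Suc N) e (a - (a - Var N * b))"
    using form by (rule form_of_degree_diff)
  then have "form_of_degree (Suc N) (e - 1) b"
    using polys_mono [OF le_SucI [OF order_refl] b]
    by (intro form_of_degree_Var_cofactor [of _ _ N]) simp_all
  with b show "form_of_degree N (e - 1) b"
    by (simp add: form_of_degree_def)
qed

text \<open>
  The step where the implicit equation produces the gcd. It rests on the primality of the kernel:
  the target of the substitution is a domain, and \<open>psubst s a \<noteq> 0\<close> keeps every divisor of \<open>a\<close> out of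
  the kernel, so a common divisor of \<open>a\<close> and \<open>b\<close> can be cancelled without leaving the kernel.
\<close>

lemma linear_kernel_element_gcd:
  fixes a b F :: "'a::idom mpoly"
  assumes a: "a \<in> polys N" and b: "b \<in> polys N" "b \<noteq> 0"
    and kernel: "{P \<in> polys (Suc N). psubst s P = 0} = {F * Q |Q. Q \<in> polys (Suc N)}"
    and vanish: "psubst s (a - Var N * b) = 0" and a_nz: "psubst s a \<noteq> 0"
  obtains R where "a - Var N * b = F * R" "is_gcd N R a b"
proof -
  have up: "p \<in> polys (Suc N)" if "p \<in> polys N" for p :: "'a mpoly"
    using that by (rule polys_mono [rotated]) simp
  let ?at = "\<lambda>c. Var(N := c) :: nat \<Rightarrow> 'a mpoly"
  have at: "psubst (?at c) p = p" if "p \<in> polys N" for p c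
    using that by (intro psubst_fixes) auto
  have "a - Var N * b \<in> polys (Suc N)"
    using a b by (intro polys_diff polys_mult Var_in_polys up) simp_all
  with vanish kernel obtain R where R: "a - Var N * b = F * R"
    by blast
  \<comment> \<open>used with \<open>c = 0\<close> and \<open>c = 1\<close>: together these values recover the coefficients \<open>a\<close> and \<open>b\<close>\<close>
  have at_R: "a - c * b = psubst (?at c) F * psubst (?at c) R" for c
  proof -
    have "psubst (?at c) (a - Var N * b) = psubst (?at c) (F * R)"
      by (simp add: R)
    then show ?thesis
      using a b by (simp add: psubst_diff psubst_mult at)
  qed
  have "a \<noteq> 0"
    using a_nz by auto
  then have F_nz: "F \<noteq> 0" and R_nz: "R \<noteq> 0"
    using at_R [of 0] by auto
  have F_zero: "psubst s F = 0"
  proof -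
    have "F * 1 \<in> {F * Q |Q. Q \<in> polys (Suc N)}"
      using form_of_degree_1 [of "Suc N"] unfolding form_of_degree_def by blast
    then show ?thesis
      unfolding kernel [symmetric] by simp
  qed
  have "F \<notin> polys N"
  proof
    assume "F \<in> polys N"
    then have "a = F * psubst (?at 0) R"
      using at_R [of 0] by (simp add: at)
    then have "psubst s a = 0"
      by (simp only: psubst_mult F_zero) simp
    with a_nz show False
      by simp
  qed
  moreover have "degree_beyond N F + degree_beyond N R \<le> 1"
  proof -
    have "degree_beyond N (Var N * b) \<le> 1"
    proof -
      have "(Var N :: 'a mpoly) \<noteq> 0"
        by (metis Var_def lookup_single_eq lookup_zero zero_neq_one)
      then show ?thesis
        using b degree_beyond_Var [of N, where ?'a = 'a]
        by (simp add: weighted_degree_mult polys_iff_degree_beyond)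
    qed
    then have "degree_beyond N (F * R) \<le> 1"
      using a unfolding R [symmetric]
      by (intro weighted_degree_diff_le) (simp_all add: polys_iff_degree_beyond)
    then show ?thesis
      using F_nz R_nz by (simp add: weighted_degree_mult)
  qed
  ultimately have R_polys: "R \<in> polys N"
    by (simp add: polys_iff_degree_beyond)
  have "is_gcd N R a b"
    unfolding is_gcd_def
  proof (intro conjI ballI impI)
    show "R dvd a"
      using at_R [of 0] R_polys by (simp add: at)
    moreover have "R dvd a - b"
      using at_R [of 1] R_polys by (simp add: at)
    ultimately show "R dvd b"
      by (metis dvd_diff diff_diff_eq2 add_diff_cancel_left')
  next
    fix c assume c: "c \<in> polys N" and "c dvd a \<and> c dvd b"
    then obtain a' b' where a': "a = c * a'" and b': "b = c * b'"
      by (auto elim!: dvdE)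
    have "a' \<in> polys N"
      using a \<open>a \<noteq> 0\<close> unfolding a' by (rule polys_cofactor)
    moreover have "b' \<in> polys N"
      using b unfolding b' by (rule polys_cofactor)
    ultimately have "a' - Var N * b' \<in> polys (Suc N)"
      by (intro polys_diff polys_mult Var_in_polys up) simp_all
    have c_nz: "psubst s c \<noteq> 0"
      using a_nz unfolding a' by (auto simp: psubst_mult)
    have cP: "c * (a' - Var N * b') = F * R"
      unfolding R [symmetric] a' b' by (simp add: algebra_simps)
    have "psubst s c * psubst s (a' - Var N * b') = 0"
      using vanish unfolding R cP [symmetric] by (simp add: psubst_mult)
    with c_nz have "psubst s (a' - Var N * b') = 0"
      by simp
    with \<open>a' - Var N * b' \<in> polys (Suc N)\<close> kernel obtain S where "a' - Var N * b' = F * S"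
      by blast
    with cP have "F * R = F * (c * S)"
      by (metis mult.left_commute)
    with F_nz show "c dvd R"
      by simp
  qed (rule R_polys)
  with R that show ?thesis
    by blast
qed

lemma is_gcd_unique:
  fixes a b :: "'a::idom mpoly"
  assumes "is_gcd N h a b" "is_gcd N R a b" "a \<noteq> 0"
  obtains c where "c \<noteq> 0" "R = Const c * h"
proof -
  have "h dvd R" "R dvd h"
    using assms by (auto simp: is_gcd_def)
  then obtain u v where u: "R = h * u" and v: "h = R * v"
    unfolding dvd_def by blast
  have "h \<noteq> 0"
    using assms by (auto simp: is_gcd_def)
  moreover have "h * (u * v) = h * 1"
    using u v by (metis mult.assoc mult_1_right)
  ultimately have uv: "u * v = 1"
    by (metis mult_left_cancel)
  then have nz: "u \<noteq> 0" "v \<noteq> 0"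
    by auto
  have "total_degree (u * v) = 0"
    unfolding uv using total_degree_form [OF form_of_degree_1, where ?'a = 'a] by simp
  then have "total_degree u = 0"
    using nz by (simp add: total_degree_mult)
  then obtain c where "u = Const c"
    by (rule total_degree_eq_0_imp_Const)
  with u nz have "R = Const c * h" "c \<noteq> 0"
    by (auto simp: mult.commute)
  with that show ?thesis
    by blast
qed

section \<open>Implicitization along a Cremona map\<close>

text \<open>
  The tuple \<open>g'(g)\<close> is proportional to \<open>(x\<^sub>0, \<dots>, x\<^sub>n)\<close>. The factor of proportionality is
  the fraction \<open>g'\<^sub>j(g) / x\<^sub>j\<close>; the power of \<open>x\<^sub>j\<close> on the left clears its denominator.
\<close>

lemma psubst_through_inverse:
  fixes G G' :: "nat \<Rightarrow> 'a::comm_ring_1 mpoly"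
  assumes G': "\<And>i. i \<le> n \<Longrightarrow> form_of_degree (n + 1) d' (G' i)"
    and proportional_id: "\<And>i. i \<le> n \<Longrightarrow> psubst G (G' i) * Var j = psubst G (G' j) * Var i"
    and s: "\<And>i. i \<le> n \<Longrightarrow> s i = f * G i"
    and h: "form_of_degree (n + 1) e h"
  shows "Var j ^ e * psubst s (psubst G' h) = (f ^ d' * psubst G (G' j)) ^ e * h"
proof -
  have "psubst s (G' i) = f ^ d' * psubst G (G' i)" if "i \<le> n" for i
    using that s by (intro psubst_scale [OF G']) auto
  then have "psubst s (psubst G' h) = psubst (\<lambda>i. f ^ d' * psubst G (G' i)) h"
    unfolding psubst_psubst using h
    by (intro psubst_cong [of h "n + 1"]) (auto simp: form_of_degree_def)
  also have "Var j ^ e * \<dots> = psubst (\<lambda>i. (f ^ d' * psubst G (G' j)) * Var i) h"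
  proof (rule psubst_scale [OF h, symmetric])
    fix i assume "i < n + 1"
    then have "psubst G (G' i) * Var j = psubst G (G' j) * Var i"
      by (intro proportional_id) simp
    then have "f ^ d' * (psubst G (G' i) * Var j) = f ^ d' * (psubst G (G' j) * Var i)"
      by (rule arg_cong)
    then show "f ^ d' * psubst G (G' j) * Var i = Var j * (f ^ d' * psubst G (G' i))"
      by (simp only: ac_simps)
  qed
  also have "\<dots> = (f ^ d' * psubst G (G' j)) ^ e * psubst Var h"
    by (rule psubst_scale [OF h refl])
  finally show ?thesis
    by (simp only: psubst_Var_id)
qed

text \<open>
  With \<open>p = g'\<^sub>j(g)\<close>, so that \<open>p / x\<^sub>j\<close> is the factor of proportionality, computing
  \<open>g\<^sub>k(g'(g))\<close> in two ways gives \<open>D(g) = (p / x\<^sub>j)\<^sup>d\<close>: the target inversion factor pulled back along the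
  Cremona map is a power of the source inversion factor. This and \<open>e + 1 = d d'\<close> make
  the images of \<open>g(g')\<close> and of \<open>y\<^sub>n\<^sub>+\<^sub>1 f(g') D\<close> equal.
\<close>

lemma cremona_implicit_vanishing:
  fixes G G' :: "nat \<Rightarrow> 'a::idom mpoly"
  assumes G: "\<And>i. i \<le> n \<Longrightarrow> form_of_degree (n + 1) d (G i)" and G_nz: "k \<le> n" "G k \<noteq> 0"
    and G': "\<And>i. i \<le> n \<Longrightarrow> form_of_degree (n + 1) d' (G' i)"
    and proportional_id: "\<And>i. i \<le> n \<Longrightarrow> psubst G (G' i) * Var j = psubst G (G' j) * Var i"
    and nz: "psubst G (G' j) \<noteq> 0"
    and D: "form_of_degree (n + 1) e D" "\<And>i. i \<le> n \<Longrightarrow> psubst G' (G i) = Var i * D"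
    and e: "e + 1 = d * d'"
    and f: "form_of_degree (n + 1) df f" "f \<noteq> 0"
    and g: "form_of_degree (n + 1) (d + df) g" "g \<noteq> 0"
    and s: "\<And>i. i \<le> n \<Longrightarrow> s i = f * G i" "s (n + 1) = g"
  shows "psubst s (psubst G' g - Var (n + 1) * (psubst G' f * D)) = 0"
    and "psubst s (psubst G' g) \<noteq> 0"
proof -
  let ?p = "psubst G (G' j)" and ?x = "Var j :: 'a mpoly"
  have x_nz: "?x \<noteq> 0"
    by (metis Var_def lookup_single_eq lookup_zero zero_neq_one)
  have *: "?x ^ e * psubst s (psubst G' h) = (f ^ d' * ?p) ^ e * h"
    if "form_of_degree (n + 1) e h" for e h
    using G' proportional_id s(1) that by (rule psubst_through_inverse)
  \<comment> \<open>the previous lemma for the unscaled substitution, i.e. with the factor \<open>f\<close> replaced by 1\<close>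
  have "?x ^ d * psubst G (psubst G' (G k)) = (1 ^ d' * ?p) ^ d * G k"
    using G_nz by (intro psubst_through_inverse [OF G' proportional_id _ G]) auto
  then have "?x ^ d * psubst G D * G k = ?p ^ d * G k"
    using D(2) [OF G_nz(1)] by (simp add: psubst_mult algebra_simps)
  then have D_G: "?x ^ d * psubst G D = ?p ^ d"
    using G_nz by simp
  have D_s: "psubst s D = f ^ e * psubst G D"
    using s(1) by (intro psubst_scale [OF D(1)]) auto
  have "?x ^ (d + df) * psubst s (Var (n + 1) * (psubst G' f * D)) =
      g * (?x ^ df * psubst s (psubst G' f)) * (f ^ e * (?x ^ d * psubst G D))"
    using s(2) by (simp add: psubst_mult D_s power_add algebra_simps)
  also have "\<dots> = g * ((f ^ d' * ?p) ^ df * f) * (f ^ e * ?p ^ d)"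
    by (simp only: * [OF f(1)] D_G)
  also have "\<dots> = (f ^ d') ^ df * f ^ (e + 1) * ?p ^ (d + df) * g"
    by (simp add: power_mult_distrib power_add algebra_simps)
  also have "\<dots> = (f ^ d' * ?p) ^ (d + df) * g"
    unfolding e by (simp add: power_mult_distrib power_add algebra_simps flip: power_mult)
  also have "\<dots> = ?x ^ (d + df) * psubst s (psubst G' g)"
    by (rule * [OF g(1), symmetric])
  finally show "psubst s (psubst G' g - Var (n + 1) * (psubst G' f * D)) = 0"
    using x_nz by (simp add: psubst_diff)
  show "psubst s (psubst G' g) \<noteq> 0"
    using * [OF g(1)] f(2) g(2) nz by auto
qed

theorem proposition3p2:
  fixes n d d' :: nat
    and G G' :: "nat \<Rightarrow> 'a::field mpoly"
    and D f g F :: "'a mpoly"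
  assumes infinite_field: "infinite (UNIV :: 'a set)"
    and cremona: "cremona_map n d G"
    and inverse: "cremona_inverse n G d' G'"
    and factor: "target_inversion_factor n G G' D"
    and f_form: "form (n + 1) f"
    and g_form: "form (n + 1) g"
    and rel_prime: "no_common_factor (n + 1) {f, g}"
    and deg_f: "total_degree f \<ge> 1"
    and deg_g: "total_degree g = d + total_degree f"
    and f_nonzero: "psubst G' f \<noteq> 0"
    and g_nonzero: "psubst G' g \<noteq> 0"
    and implicit: "implicit_equation (n + 2) (\<lambda>i. if i \<le> n then f * G i else g) F"
  shows "let a = psubst G' g; b = psubst G' f * D in
    (\<exists>h. is_gcd (n + 1) h a b) \<and>
    (\<forall>h. is_gcd (n + 1) h a b \<longrightarrow>
      (\<exists>Q. Q * h = a - Var (n + 1) * b \<and> monoid_form n Q \<and>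
           (\<exists>c. c \<noteq> 0 \<and> F = Const c * Q)) \<and>
      int (total_degree F) =
        int (total_degree g) * int d' - int (total_degree h) \<and>
      int (total_degree g) * int d' - int (total_degree h) =
        int (total_degree f) * int d' + int (total_degree D) + 1 - int (total_degree h)) \<and>
    total_degree F \<le> total_degree g * d'"
proof -
  define a b where "a = psubst G' g" and "b = psubst G' f * D"
  define P where "P = a - Var (n + 1) * b"
  define s where "s = (\<lambda>i. if i \<le> n then f * G i else g)"
  define df e where "df = total_degree f" and "e = total_degree D"
  have G: "form_of_degree (n + 1) d (G i)" and G': "form_of_degree (n + 1) d' (G' i)"
    if "i \<le> n" for i
    using that cremona inverse by (auto simp: cremona_map_def cremona_inverse_def rational_map_def)
  have D: "psubst G' (G i) = Var i * D" if "i \<le> n" for i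
    using that factor by (auto simp: target_inversion_factor_def)
  obtain k where k: "k \<le> n" "psubst G' (G k) \<noteq> 0"
    using inverse by (auto simp: cremona_inverse_def mutually_inverse_def composes_to_id_def)
  obtain j where j: "j \<le> n" "psubst G (G' j) \<noteq> 0"
    and proportional_id: "\<And>i. i \<le> n \<Longrightarrow> psubst G (G' i) * Var j = psubst G (G' j) * Var i"
    using inverse unfolding cremona_inverse_def mutually_inverse_def composes_to_id_def
      proportional_def by blast
  have nz: "G k \<noteq> 0" "D \<noteq> 0" "f \<noteq> 0" "g \<noteq> 0" "a \<noteq> 0" "b \<noteq> 0"
    using k D [OF k(1)] f_nonzero g_nonzero by (auto simp: a_def b_def)
  have D_form: "form_of_degree (n + 1) e D"
    using factor nz unfolding e_def target_inversion_factor_def by (blast intro: form_of_total_degree)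
  have f_deg: "form_of_degree (n + 1) df f"
    using f_form nz unfolding df_def by (blast intro: form_of_total_degree)
  have g_deg: "form_of_degree (n + 1) (d + df) g"
    using form_of_total_degree [OF g_form] nz deg_g unfolding df_def by simp
  have e: "e + 1 = d * d'"
  proof -
    have "form_of_degree (n + 1) (1 + e) (Var k * D)"
      using k(1) by (intro form_of_degree_mult form_of_degree_Var D_form) simp
    moreover have "form_of_degree (n + 1) (d * d') (Var k * D)"
      unfolding D [OF k(1), symmetric] using G G' k(1)
      by (intro form_of_degree_psubst [of "n + 1"]) simp_all
    moreover have "Var k * D \<noteq> 0"
      using k D by simp
    ultimately show ?thesis
      by (metis total_degree_form add.commute)
  qed
  have a_form: "form_of_degree (n + 1) ((d + df) * d') a"
    unfolding a_def using G' by (intro form_of_degree_psubst [OF g_deg]) simp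
  have b_form: "form_of_degree (n + 1) (df * d' + e) b"
    unfolding b_def using G' by (intro form_of_degree_mult form_of_degree_psubst [OF f_deg] D_form) simp
  have polys: "a \<in> polys (n + 1)" "b \<in> polys (n + 1)"
    using a_form b_form by (simp_all add: form_of_degree_def)
  have "psubst s P = 0" "psubst s a \<noteq> 0"
    using cremona_implicit_vanishing [OF G k(1) nz(1) G' proportional_id j(2) D_form D e f_deg nz(3) g_deg nz(4),
        of s] by (simp_all add: P_def a_def b_def s_def)
  moreover have "{P \<in> polys (Suc (n + 1)). psubst s P = 0} = {F * Q |Q. Q \<in> polys (Suc (n + 1))}"
    using implicit by (simp add: implicit_equation_def s_def)
  ultimately obtain R where R: "P = F * R" "is_gcd (n + 1) R a b"
    using linear_kernel_element_gcd [OF polys nz(6)] unfolding P_def by blast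
  have P_form: "form_of_degree (n + 2) ((d + df) * d') P"
  proof -
    have "form_of_degree (n + 2) (1 + (df * d' + e)) (Var (n + 1) * b)"
      using b_form by (intro form_of_degree_mult form_of_degree_Var)
        (auto simp: form_of_degree_def intro: polys_mono [of "n + 1"])
    moreover have "1 + (df * d' + e) = (d + df) * d'"
      using e by (simp add: algebra_simps)
    moreover have "form_of_degree (n + 2) ((d + df) * d') a"
      using a_form by (auto simp: form_of_degree_def intro: polys_mono [of "n + 1"])
    ultimately show ?thesis
      unfolding P_def by (metis form_of_degree_diff)
  qed
  have P_nz: "P \<noteq> 0"
  proof
    assume "P = 0"
    then have "psubst (Var(n + 1 := 0)) P = 0"
      by simp
    then have "psubst (Var(n + 1 := 0)) a = 0"
      by (simp add: P_def psubst_diff psubst_mult)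
    then show False
      using psubst_fixes [OF polys(1), of "Var(n + 1 := 0)"] nz by auto
  qed
  have main: "(\<exists>Q. Q * h = P \<and> monoid_form n Q \<and> (\<exists>c. c \<noteq> 0 \<and> F = Const c * Q)) \<and>
      total_degree F + total_degree h = (d + df) * d'"
    if h: "is_gcd (n + 1) h a b" for h
  proof -
    obtain c where c: "c \<noteq> 0" "R = Const c * h"
      using is_gcd_unique [OF h R(2) nz(5)] by blast
    \<comment> \<open>\<open>P = F R = (c F) h\<close>, so the quotient by \<open>h\<close> is \<open>F\<close> up to the constant\<close>
    define Q where "Q = Const c * F"
    have Qh: "Q * h = P"
      by (simp add: Q_def R(1) c(2) algebra_simps)
    then have Q_nz: "Q \<noteq> 0" "h \<noteq> 0"
      using P_nz by auto
    have F_Q: "F = Const (1 / c) * Q"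
      using c(1) by (simp add: Q_def flip: mult.assoc Const_simps(4))
    obtain eF where "form_of_degree (n + 2) eF F"
      using implicit by (auto simp: implicit_equation_def form_def)
    then have Q_form: "form_of_degree (n + 2) eF Q"
      unfolding Q_def using form_of_degree_mult [OF form_of_degree_Const] by fastforce
    obtain a' b' where a': "a = h * a'" and b': "b = h * b'"
      using h by (auto simp: is_gcd_def elim!: dvdE)
    have cofactors: "a' \<in> polys (n + 1)" "b' \<in> polys (n + 1)"
      using polys nz unfolding a' b' by (auto intro: polys_cofactor)
    have "h * Q = h * (a' - Var (n + 1) * b')"
      using Qh unfolding P_def a' b' by (simp add: algebra_simps)
    then have Q: "Q = a' - Var (n + 1) * b'"
      using Q_nz by simp
    with Q_form have forms: "form_of_degree (n + 1) eF a'" "form_of_degree (n + 1) (eF - 1) b'"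
      using form_of_degree_linear_coefficients [OF _ cofactors] by simp_all
    moreover have "form_of_degree (n + 1) (eF - 1) (0 - b')"
      using forms by (intro form_of_degree_diff form_of_degree_0)
    moreover have "Q = a' + (0 - b') * Var (n + 1)"
      by (simp add: Q)
    ultimately have "monoid_form n Q"
      using Q_form unfolding monoid_form_def form_def by blast
    moreover have "total_degree F + total_degree h = (d + df) * d'"
    proof -
      have F_nz: "F \<noteq> 0"
        using R(1) P_nz by auto
      have "total_degree F = eF"
        using \<open>form_of_degree (n + 2) eF F\<close> F_nz by (rule total_degree_form)
      also have "\<dots> = total_degree Q"
        using total_degree_form [OF Q_form Q_nz(1)] by simp
      finally show ?thesis
        using total_degree_mult [OF Q_nz] total_degree_form [OF P_form P_nz] by (simp add: Qh)
    qed
    moreover have "1 / c \<noteq> 0"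
      using c(1) by simp
    ultimately show ?thesis
      using Qh F_Q by blast
  qed
  have degrees: "int (total_degree g) * int d' = int (total_degree f) * int d' + int (total_degree D) + 1"
    using e unfolding deg_g df_def [symmetric] e_def [symmetric]
    by (metis (no_types, opaque_lifting) add.assoc add.commute distrib_right of_nat_1 of_nat_add of_nat_mult)
  have deg: "int (total_degree F) = int (total_degree g) * int d' - int (total_degree h)"
    if "is_gcd (n + 1) h a b" for h
  proof -
    have "int (total_degree F + total_degree h) = int ((d + df) * d')"
      using main [OF that] by simp
    then show ?thesis
      by (simp add: deg_g df_def)
  qed
  have "total_degree F \<le> total_degree g * d'"
    using main [OF R(2)] by (simp add: deg_g df_def)
  with R(2) main deg degrees show ?thesis
    unfolding Let_def a_def [symmetric] b_def [symmetric] P_def [symmetric] by auto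
qed

end
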